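(* Let $\mathbb K$ be a field, $R=\mathbb K[x_1,\dots,x_n]$, let $I\subseteq R$ be a monomial ideal and $m\in R$ a monomial. If $I$ admits a minimal pruned resolution, then $I_{\le m}$ also admits a minimal pruned resolution.
   Context: For a monomial ideal $I$ with minimal monomial generators $G(I)=\{m_1,\dots,m_q\}$ and a monomial $m$, $I_{\le m}$ is the ideal generated by those $m_i\in G(I)$ that divide $m$. For a monomial ideal with minimal generators in a fixed order $m_1,\dots,m_q$ and $\sigma\subseteq\{1,\dots,q\}$ put $m_\sigma=\mathrm{lcm}(m_i: i\in\sigma)$, $m_\emptyset=1$. The Taylor resolution of $R/I$ is supported on the full simplex $X_{\mathrm{Taylor}}$ on $q$ vertices; the face $\sigma$ has homological degree $|\sigma|$ and multidegree the exponent of $m_\sigma$. Pruning algorithm: for $j=1,\dots,q$ successively (step $j$), for every $\sigma\not\ni j$ with $m_\sigma=m_{\sigma\cup\{j\}}$ and such that neither $\sigma$ nor $\sigma\cup\{j\}$ belongs to a previously selected edge, select (prune) the edge $\{\sigma,\sigma\cup\{j\}\}$. The selected edges form a homogeneous acyclic matching on $X_{\mathrm{Taylor}}$, and discrete Morse theory (Batzies–Welker) yields a $\mathbb Z^n$-graded CW-complex, with cells corresponding to the faces in no selected edge (critical faces), supporting a free resolution of $R/I$: the pruned resolution for the given order. Its module in homological degree $i$ is the direct sum of $R(-\deg m_\sigma)$ over critical $\sigma$ with $|\sigma|=i$; so it is minimal iff, for all $i,\alpha$, the number of critical $\sigma$ with $|\sigma|=i$ and multidegree $\alpha$ equals the multigraded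 Betti number $\beta_{i,\alpha}(R/I)$. A monomial ideal admits a minimal pruned resolution if there is an order of its minimal generators for which the pruned resolution is minimal. *)

theory Defs
  imports Complex_Main "HOL-Library.Poly_Mapping" "HOL-Library.Function_Algebras"
begin

text \<open>
  For a finite type \<open>'x\<close> of variables, the exponent vectors are the functions \<open>'x \<Rightarrow> nat\<close>: addition,
  zero and \<open>\<le>\<close> on them are pointwise, so \<open>s \<le> t\<close> is divisibility of monomials. The polynomial
  ring is the monoid algebra of finitely supported functions on exponent vectors, with the
  convolution product.
\<close>

type_synonym 'x expo = "'x \<Rightarrow> nat"
type_synonym ('x, 'k) mpoly = "'x expo \<Rightarrow>\<^sub>0 'k"

abbreviation monom :: "'x expo \<Rightarrow> ('x, 'k::field) mpoly" where
  "monom t \<equiv> Poly_Mapping.single t 1"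

definition ideal_of :: "'a::comm_ring_1 set \<Rightarrow> 'a set" where
  "ideal_of B = module.span (*) B"

definition monomial_ideal :: "('x, 'k::field) mpoly set \<Rightarrow> bool" where
  "monomial_ideal I \<longleftrightarrow> (\<exists>T. I = ideal_of (monom ` T))"

text \<open>The set \<open>G(I)\<close> (as exponents): the monomials of \<open>I\<close> that are minimal under divisibility.\<close>

definition min_gens :: "('x, 'k::field) mpoly set \<Rightarrow> 'x expo set" where
  "min_gens I = {t. monom t \<in> I \<and> (\<forall>s. monom s \<in> I \<longrightarrow> s \<le> t \<longrightarrow> s = t)}"

definition ideal_le :: "('x, 'k::field) mpoly set \<Rightarrow> 'x expo \<Rightarrow> ('x, 'k) mpoly set" where
  "ideal_le I m = ideal_of (monom ` {t \<in> min_gens I. t \<le> m})"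


subsection \<open>Minimal multigraded free resolutions and multigraded Betti numbers\<close>

text \<open>
  The module in homological degree \<open>i\<close> is \<open>F\<^sub>i = (\<Oplus>k<r i. R(- d i k))\<close>, the differential
  \<open>F\<^sub>i\<^sub>+\<^sub>1 \<rightarrow> F\<^sub>i\<close> is given by the matrix \<open>A i\<close> (rows \<open>k < r i\<close>, columns \<open>l < r (i + 1)\<close>), and the
  augmentation \<open>F\<^sub>0 \<rightarrow> R/I\<close> sends the \<open>k\<close>-th basis element to the class of \<open>e k\<close>. A vector of
  \<open>F\<^sub>i\<close> is a function of which only the values at indices below \<open>r i\<close> matter. Only degrees in
  \<open>\<nat>\<^sup>n\<close> are needed, as the graded Betti numbers of \<open>R/I\<close> vanish elsewhere.
\<close>

locale minimal_free_resolution =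
  fixes I :: "('x::finite, 'k::field) mpoly set"
    and r :: "nat \<Rightarrow> nat"
    and d :: "nat \<Rightarrow> nat \<Rightarrow> 'x expo"
    and e :: "nat \<Rightarrow> ('x, 'k) mpoly"
    and A :: "nat \<Rightarrow> nat \<Rightarrow> nat \<Rightarrow> ('x, 'k) mpoly"
  assumes homogeneous_augmentation:
      "\<And>k. k < r 0 \<Longrightarrow> Poly_Mapping.keys (e k) \<subseteq> {d 0 k}"
    and homogeneous_differential:
      "\<And>i k l t. k < r i \<Longrightarrow> l < r (Suc i) \<Longrightarrow> t \<in> Poly_Mapping.keys (A i k l) \<Longrightarrow> d i k + t = d (Suc i) l"
    and surjective_augmentation:
      "\<exists>v. (\<Sum>k<r 0. v k * e k) - 1 \<in> I"
    and exact_augmentation: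
      "\<And>v. (\<Sum>k<r 0. v k * e k) \<in> I \<longleftrightarrow>
         (\<exists>w. \<forall>k<r 0. v k = (\<Sum>l<r 1. A 0 k l * w l))"
    and exact_differential:
      "\<And>i v. (\<forall>k<r i. (\<Sum>l<r (Suc i). A i k l * v l) = 0) \<longleftrightarrow>
         (\<exists>w. \<forall>l<r (Suc i). v l = (\<Sum>p<r (Suc (Suc i)). A (Suc i) l p * w p))"
    and minimal:
      \<comment> \<open>all matrix entries lie in the maximal ideal generated by the variables\<close>
      "\<And>i k l. k < r i \<Longrightarrow> l < r (Suc i) \<Longrightarrow> Poly_Mapping.lookup (A i k l) 0 = 0"

text \<open>
  \<open>\<beta> i \<alpha>\<close> are the multigraded Betti numbers of \<open>R/I\<close>: the numbers of copies of \<open>R(-\<alpha>)\<close> in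
  homological degree \<open>i\<close> of a minimal multigraded free resolution of \<open>R/I\<close>. As such a resolution
  exists and is unique up to isomorphism, this determines \<open>\<beta>\<close>.
\<close>

definition multigraded_betti_numbers ::
  "('x::finite, 'k::field) mpoly set \<Rightarrow> (nat \<Rightarrow> 'x expo \<Rightarrow> nat) \<Rightarrow> bool" where
  "multigraded_betti_numbers I \<beta> \<longleftrightarrow>
     (\<exists>r d e A. minimal_free_resolution I r d e A \<and>
        (\<forall>i \<alpha>. \<beta> i \<alpha> = card {k. k < r i \<and> d i k = \<alpha>}))"


subsection \<open>The pruning algorithm\<close>

text \<open>
  The ordered generators form a list \<open>ms\<close>, indexed from \<open>0\<close>. Faces of the Taylor simplex are the
  subsets of \<open>{..<length ms}\<close>, including the empty one, which has homological degree \<open>0\<close>.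
\<close>

definition lcm_face :: "'x expo list \<Rightarrow> nat set \<Rightarrow> 'x expo" where
  "lcm_face ms \<sigma> = (\<lambda>x. Max (insert 0 ((\<lambda>i. (ms ! i) x) ` \<sigma>)))"

text \<open>
  Step \<open>j\<close>, where \<open>E\<close> is the set of edges selected in earlier steps. Distinct candidate edges of
  the same step are disjoint, so they can be selected simultaneously.
\<close>

definition prune_step :: "'x expo list \<Rightarrow> nat \<Rightarrow> nat set set set \<Rightarrow> nat set set set" where
  "prune_step ms j E = E \<union>
     {{\<sigma>, insert j \<sigma>} | \<sigma>. \<sigma> \<subseteq> {..<length ms} \<and> j \<notin> \<sigma> \<and>
        lcm_face ms \<sigma> = lcm_face ms (insert j \<sigma>) \<and> \<sigma> \<notin> \<Union>E \<and> insert j \<sigma> \<notin> \<Union>E}"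

definition pruned_edges :: "'x expo list \<Rightarrow> nat set set set" where
  "pruned_edges ms = fold (prune_step ms) [0..<length ms] {}"

definition critical_faces :: "'x expo list \<Rightarrow> nat set set" where
  "critical_faces ms = Pow {..<length ms} - \<Union>(pruned_edges ms)"

definition admits_minimal_pruned_resolution :: "('x::finite, 'k::field) mpoly set \<Rightarrow> bool" where
  "admits_minimal_pruned_resolution I \<longleftrightarrow>
     (\<exists>ms. distinct ms \<and> set ms = min_gens I \<and>
        multigraded_betti_numbers I
          (\<lambda>i \<alpha>. card {\<sigma> \<in> critical_faces ms. card \<sigma> = i \<and> lcm_face ms \<sigma> = \<alpha>}))"

end

theory Submission
  imports Defs
begin

text \<open>
  Order the generators of \<open>I\<^sub>\<le>\<^sub>m\<close> as in the given order of \<open>G(I)\<close>. All edges of the pruning algorithm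
  join faces of equal multidegree, so pruning the smaller Taylor simplex amounts to pruning the
  faces of the larger one whose multidegree divides \<open>m\<close>. On the side of Betti numbers, a minimal
  free resolution of \<open>R/I\<close> restricted to its basis elements of degree dividing \<open>m\<close> is a minimal free
  resolution of \<open>R/I\<^sub>\<le>\<^sub>m\<close>, as in degree \<open>s\<close> it coincides with the original one in degree
  \<open>gcd(s, m)\<close>. Hence the critical faces of both simplices are counted by the respective Betti
  numbers; no discrete Morse theory is needed.
\<close>


section \<open>Exactness of homogeneous matrices, degree by degree\<close>

lemma expo_diff_add: "s \<le> t \<Longrightarrow> (t - s) + s = t" for s t :: "'x expo"
  by (auto simp: le_fun_def fun_eq_iff)

lemma expo_add_diff: "s \<le> t \<Longrightarrow> s + (t - s) = t" for s t :: "'x expo"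
  by (auto simp: le_fun_def fun_eq_iff)

lemma expo_add_eq_iff: "s + u = t \<longleftrightarrow> s \<le> t \<and> u = t - s" for s t u :: "'x expo"
  by (auto simp: le_fun_def fun_eq_iff dest: sym) (metis le_add1, metis diff_add_inverse)

lemma poly_mapping_sum_single: "f = (\<Sum>u\<in>Poly_Mapping.keys f. Poly_Mapping.single u (Poly_Mapping.lookup f u))"
  by (rule poly_mapping_eqI)
    (simp add: lookup_sum lookup_single when_def not_in_keys_iff_lookup_eq_zero)

lemma lookup_single_times:
  fixes f :: "('x, 'k::field) mpoly"
  shows "Poly_Mapping.lookup (Poly_Mapping.single t c * f) v
    = (if t \<le> v then c * Poly_Mapping.lookup f (v - t) else 0)"
proof -
  have "Poly_Mapping.single t c * f
    = (\<Sum>u\<in>Poly_Mapping.keys f. Poly_Mapping.single (t + u) (c * Poly_Mapping.lookup f u))"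
    by (subst poly_mapping_sum_single[of f]) (simp add: sum_distrib_left mult_single)
  then have "Poly_Mapping.lookup (Poly_Mapping.single t c * f) v
    = (\<Sum>u\<in>Poly_Mapping.keys f. if u = v - t \<and> t \<le> v then c * Poly_Mapping.lookup f u else 0)"
    by (auto simp: lookup_sum lookup_single when_def expo_add_eq_iff intro!: sum.cong)
  also have "\<dots> = (if t \<le> v then c * Poly_Mapping.lookup f (v - t) else 0)"
    by (auto simp: not_in_keys_iff_lookup_eq_zero)
  finally show ?thesis .
qed

text \<open>The coordinate of \<open>f\<close>, viewed in \<open>R(-d)\<close>, in degree
  \<open>b\<close>: that part of \<open>R(-d)\<close> is spanned by the monomial of exponent
  \<open>b - d\<close> if \<open>d \<le> b\<close> and is zero otherwise. The case distinction is
  essential because subtraction of exponents is truncated.\<close>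

definition graded_coeff :: "'x expo \<Rightarrow> 'x expo \<Rightarrow> ('x, 'k::field) mpoly \<Rightarrow> 'k" where
  "graded_coeff d b f = (if d \<le> b then Poly_Mapping.lookup f (b - d) else 0)"

lemma graded_coeff_sum: "graded_coeff d b (sum f S) = (\<Sum>x\<in>S. graded_coeff d b (f x))"
  by (simp add: graded_coeff_def lookup_sum)

lemma graded_coeff_single:
  "d \<le> b' \<Longrightarrow> graded_coeff d b (Poly_Mapping.single (b' - d) c) = (if b = b' then c else 0)"
  by (auto simp: graded_coeff_def lookup_single when_def dest!: expo_diff_add)

text \<open>The shift by \<open>d\<close> loses nothing: every exponent \<open>t\<close> equals
  \<open>b - d\<close> for \<open>b = d + t\<close>.\<close>

lemma keys_subset_iff_graded_coeff:
  "Poly_Mapping.keys f \<subseteq> M \<longleftrightarrow> (\<forall>b. graded_coeff d b f = 0 \<or> b - d \<in> M)"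
proof
  assume R: "\<forall>b. graded_coeff d b f = 0 \<or> b - d \<in> M"
  show "Poly_Mapping.keys f \<subseteq> M"
  proof
    fix t assume "t \<in> Poly_Mapping.keys f"
    moreover have "d \<le> d + t" "d + t - d = t"
      by (auto simp: le_fun_def fun_eq_iff)
    ultimately show "t \<in> M"
      using R[rule_format, of "d + t"] by (simp add: graded_coeff_def in_keys_iff)
  qed
qed (auto simp: graded_coeff_def in_keys_iff)

lemma eq_iff_graded_coeff: "f = g \<longleftrightarrow> (\<forall>b. graded_coeff d b f = graded_coeff d b g)"
proof -
  have "f = g \<longleftrightarrow> Poly_Mapping.keys (f - g) \<subseteq> {}"
    by (metis eq_iff_diff_eq_0 keys_zero order_refl poly_mapping_sum_single subset_empty sum.empty)
  then show ?thesis
    unfolding keys_subset_iff_graded_coeff[of _ _ d] by (simp add: graded_coeff_def lookup_minus)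
qed

text \<open>Here \<open>a\<close> and \<open>b\<close> are the degrees of rows and columns, so
  \<open>A\<close> describes a degree-preserving map. An entry must vanish unless
  \<open>a k \<le> b l\<close>.\<close>

definition homogeneous_matrix ::
  "'i set \<Rightarrow> 'j set \<Rightarrow> ('i \<Rightarrow> 'x expo) \<Rightarrow> ('j \<Rightarrow> 'x expo) \<Rightarrow> ('i \<Rightarrow> 'j \<Rightarrow> ('x, 'k::field) mpoly) \<Rightarrow> bool" where
  "homogeneous_matrix K L a b A \<longleftrightarrow>
     (\<forall>k\<in>K. \<forall>l\<in>L. \<forall>t\<in>Poly_Mapping.keys (A k l). a k + t = b l)"

lemma homogeneous_matrixD:
  assumes "homogeneous_matrix K L a b A" "k \<in> K" "l \<in> L"
  shows "A k l = Poly_Mapping.single (b l - a k) (graded_coeff (a k) (b l) (A k l))"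
proof -
  have "Poly_Mapping.keys (A k l) \<subseteq> (if a k \<le> b l then {b l - a k} else {})"
    using assms by (fastforce simp: homogeneous_matrix_def expo_add_eq_iff)
  then show ?thesis
    by (intro poly_mapping_eqI) (auto simp: graded_coeff_def lookup_single when_def
      not_in_keys_iff_lookup_eq_zero[symmetric] simp del: not_in_keys_iff_lookup_eq_zero keys_eq_empty split: if_splits)
qed

lemma graded_coeff_zero_degree: "graded_coeff d b f = 0" if "\<not> d \<le> b"
  using that by (simp add: graded_coeff_def)

text \<open>Multiplication by the monomial of exponent \<open>b - a\<close> is a degree-preserving
  map from \<open>R(-b)\<close> to \<open>R(-a)\<close>, so in each degree only the scalar
  \<open>c\<close> remains.\<close>

lemma graded_coeff_single_times:
  assumes "a \<le> b"
  shows "graded_coeff a s (Poly_Mapping.single (b - a) c * f) = c * graded_coeff b s f"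
proof -
  have "s - a - (b - a) = s - b" "a \<le> s \<and> b - a \<le> s - a \<longleftrightarrow> b \<le> s"
    using assms by (auto simp: fun_eq_iff le_fun_def)
       (metis diff_diff_eq diff_le_mono le_add_diff_inverse le_trans nat_le_linear diff_is_0_eq le_diff_iff)+
  then show ?thesis
    by (auto simp: graded_coeff_def lookup_single_times)
qed

text \<open>In degree \<open>s\<close> a homogeneous matrix acts through the scalars of its entries.
  A column with \<open>b l\<close> not dividing \<open>s\<close> drops out, as
  \<open>R(- b l)\<close> vanishes in degree \<open>s\<close>.\<close>

lemma graded_coeff_mult_vector:
  assumes "homogeneous_matrix K L a b A" "k \<in> K" "finite L"
  shows "graded_coeff (a k) s (\<Sum>l\<in>L. A k l * v l)
    = (\<Sum>l\<in>{l\<in>L. b l \<le> s}. graded_coeff (a k) (b l) (A k l) * graded_coeff (b l) s (v l))"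
proof -
  have "graded_coeff (a k) s (A k l * v l)
      = graded_coeff (a k) (b l) (A k l) * graded_coeff (b l) s (v l)" if "l \<in> L" for l
  proof (cases "a k \<le> b l")
    case True
    then show ?thesis
      by (subst homogeneous_matrixD[OF assms(1,2) that]) (simp add: graded_coeff_single_times)
  next
    case False
    then have "graded_coeff (a k) (b l) (A k l) = 0"
      by (rule graded_coeff_zero_degree)
    with homogeneous_matrixD[OF assms(1,2) that] show ?thesis
      by (simp add: graded_coeff_def)
  qed
  then show ?thesis
    unfolding graded_coeff_sum using assms(3)
    by (intro sum.mono_neutral_cong_right) (auto simp: graded_coeff_zero_degree)
qed

text \<open>The set \<open>M\<close> of exponents treats both kinds of exactness alike: for \<open>M = {}\<close> the left-hand
  side says that \<open>v\<close> lies in the kernel of \<open>A\<close>, and for the set of exponents of the monomials of \<open>I\<close>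
  that \<open>A\<close> maps \<open>v\<close> to zero modulo \<open>I\<close>.\<close>

definition exact_on ::
  "'x expo set \<Rightarrow> 'i set \<Rightarrow> 'j set \<Rightarrow> 'l set \<Rightarrow> ('i \<Rightarrow> 'j \<Rightarrow> ('x, 'k::field) mpoly) \<Rightarrow> ('j \<Rightarrow> 'l \<Rightarrow> ('x, 'k) mpoly) \<Rightarrow> bool"
  where "exact_on M K L P A B \<longleftrightarrow>
    (\<forall>v. (\<forall>k\<in>K. Poly_Mapping.keys (\<Sum>l\<in>L. A k l * v l) \<subseteq> M) \<longleftrightarrow>
      (\<exists>w. \<forall>l\<in>L. v l = (\<Sum>p\<in>P. B l p * w p)))"

text \<open>The linear algebra over the field that \<open>exact_on\<close> amounts to in the single
  degree \<open>s\<close>: \<open>v\<close> and \<open>w\<close> have scalar entries, and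
  \<open>s - a k\<close> is the exponent of the monomial spanning row \<open>k\<close> in degree
  \<open>s\<close>.\<close>

definition exact_in_degree ::
  "'x expo \<Rightarrow> 'x expo set \<Rightarrow> 'i set \<Rightarrow> 'j set \<Rightarrow> 'l set \<Rightarrow> ('i \<Rightarrow> 'x expo) \<Rightarrow> ('j \<Rightarrow> 'x expo) \<Rightarrow> ('l \<Rightarrow> 'x expo)
    \<Rightarrow> ('i \<Rightarrow> 'j \<Rightarrow> ('x, 'k::field) mpoly) \<Rightarrow> ('j \<Rightarrow> 'l \<Rightarrow> ('x, 'k) mpoly) \<Rightarrow> bool"
  where "exact_in_degree s M K L P a b c A B \<longleftrightarrow>
    (\<forall>v. (\<forall>k\<in>{k\<in>K. a k \<le> s}.
            (\<Sum>l\<in>{l\<in>L. b l \<le> s}. graded_coeff (a k) (b l) (A k l) * v l) = 0 \<or> s - a k \<in> M) \<longleftrightarrow>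
      (\<exists>w. \<forall>l\<in>{l\<in>L. b l \<le> s}. v l = (\<Sum>p\<in>{p\<in>P. c p \<le> s}. graded_coeff (b l) (c p) (B l p) * w p)))"

section \<open>Kernels, images and exactness degree by degree\<close>

lemma kernel_iff_graded:
  assumes "homogeneous_matrix K L a b A" "finite L"
  shows "(\<forall>k\<in>K. Poly_Mapping.keys (\<Sum>l\<in>L. A k l * v l) \<subseteq> M) \<longleftrightarrow>
    (\<forall>s. \<forall>k\<in>{k\<in>K. a k \<le> s}. (\<Sum>l\<in>{l\<in>L. b l \<le> s}.
       graded_coeff (a k) (b l) (A k l) * graded_coeff (b l) s (v l)) = 0 \<or> s - a k \<in> M)"
proof -
  have "Poly_Mapping.keys (\<Sum>l\<in>L. A k l * v l) \<subseteq> M \<longleftrightarrow>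
    (\<forall>s. a k \<le> s \<longrightarrow> (\<Sum>l\<in>{l\<in>L. b l \<le> s}.
       graded_coeff (a k) (b l) (A k l) * graded_coeff (b l) s (v l)) = 0 \<or> s - a k \<in> M)" if "k \<in> K" for k
    unfolding keys_subset_iff_graded_coeff[of _ _ "a k"] graded_coeff_mult_vector[OF assms(1) that assms(2), symmetric]
    by (metis graded_coeff_zero_degree)
  then show ?thesis
    by blast
qed

text \<open>Unlike the kernel condition, this does not yet split into independent degrees: one
  polynomial vector \<open>w\<close> has to serve all \<open>s\<close>.\<close>

lemma image_iff_graded:
  assumes "homogeneous_matrix L P b c B" "finite P"
  shows "(\<forall>l\<in>L. v l = (\<Sum>p\<in>P. B l p * w p)) \<longleftrightarrow>
    (\<forall>s. \<forall>l\<in>{l\<in>L. b l \<le> s}. graded_coeff (b l) s (v l)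
       = (\<Sum>p\<in>{p\<in>P. c p \<le> s}. graded_coeff (b l) (c p) (B l p) * graded_coeff (c p) s (w p)))"
proof -
  have "v l = (\<Sum>p\<in>P. B l p * w p) \<longleftrightarrow>
    (\<forall>s. b l \<le> s \<longrightarrow> graded_coeff (b l) s (v l)
       = (\<Sum>p\<in>{p\<in>P. c p \<le> s}. graded_coeff (b l) (c p) (B l p) * graded_coeff (c p) s (w p)))"
    if "l \<in> L" for l
    unfolding eq_iff_graded_coeff[of _ _ "b l"] graded_coeff_mult_vector[OF assms(1) that assms(2), symmetric]
    by (metis graded_coeff_zero_degree)
  then show ?thesis
    by blast
qed

lemma finite_degrees: "finite {s. graded_coeff b s f \<noteq> 0}"
proof (rule finite_subset)
  show "{s. graded_coeff b s f \<noteq> 0} \<subseteq> (\<lambda>t. b + t) ` Poly_Mapping.keys f"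
    by (auto simp: graded_coeff_def in_keys_iff expo_add_diff split: if_splits intro!: rev_image_eqI)
qed simp

text \<open>Coordinates may be prescribed freely in finitely many degrees; finiteness of
  \<open>S\<close> gives a polynomial instead of a power series.\<close>

lemma exists_graded_coeff:
  assumes "finite S"
  shows "\<exists>f. \<forall>s. graded_coeff b s f = (if s \<in> S \<and> b \<le> s then c s else 0)"
proof
  show "\<forall>s. graded_coeff b s (\<Sum>u\<in>{u\<in>S. b \<le> u}. Poly_Mapping.single (u - b) (c u))
    = (if s \<in> S \<and> b \<le> s then c s else 0)"
    using assms by (simp add: graded_coeff_sum graded_coeff_single)
qed

text \<open>From left to right, scalar vectors are placed in degree \<open>s\<close>. Conversely,
  preimages chosen separately in each degree are glued, which works since a polynomial vector lives
  in finitely many degrees.\<close>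

lemma exact_on_iff_exact_in_degree:
  fixes A :: "'i \<Rightarrow> 'j \<Rightarrow> ('x, 'k::field) mpoly" and B :: "'j \<Rightarrow> 'l \<Rightarrow> ('x, 'k) mpoly"
  assumes A: "homogeneous_matrix K L a b A" and B: "homogeneous_matrix L P b c B"
    and fin: "finite L" "finite P"
  shows "exact_on M K L P A B \<longleftrightarrow> (\<forall>s. exact_in_degree s M K L P a b c A B)"
proof (intro iffI allI)
  fix s
  assume ex: "exact_on M K L P A B"
  show "exact_in_degree s M K L P a b c A B"
    unfolding exact_in_degree_def
  proof
    fix v :: "'j \<Rightarrow> 'k"
    \<comment> \<open>The vector \<open>f\<close> is concentrated in degree \<open>s\<close> and has
      the coordinates \<open>v\<close> there.\<close>
    have "\<forall>l. \<exists>f. \<forall>u. graded_coeff (b l) u f = (if u \<in> {s} \<and> b l \<le> u then v l else 0)"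
      by (intro allI exists_graded_coeff) simp
    then obtain f where f: "\<And>l u. graded_coeff (b l) u (f l) = (if u = s \<and> b l \<le> u then v l else 0)"
      by (metis singleton_iff)
    have sum_f: "(\<Sum>l\<in>{l\<in>L. b l \<le> u}. graded_coeff (a k) (b l) (A k l) * graded_coeff (b l) u (f l))
      = (if u = s then \<Sum>l\<in>{l\<in>L. b l \<le> s}. graded_coeff (a k) (b l) (A k l) * v l else 0)" for k u
      by (auto simp: f intro!: sum.cong)
    have "(\<forall>k\<in>{k\<in>K. a k \<le> s}.
            (\<Sum>l\<in>{l\<in>L. b l \<le> s}. graded_coeff (a k) (b l) (A k l) * v l) = 0 \<or> s - a k \<in> M)
      \<longleftrightarrow> (\<forall>k\<in>K. Poly_Mapping.keys (\<Sum>l\<in>L. A k l * f l) \<subseteq> M)"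
      unfolding kernel_iff_graded[OF A fin(1)] sum_f by auto
    also have "\<dots> \<longleftrightarrow> (\<exists>w. \<forall>l\<in>L. f l = (\<Sum>p\<in>P. B l p * w p))"
      using ex by (simp add: exact_on_def)
    also have "\<dots> \<longleftrightarrow> (\<exists>w. \<forall>l\<in>{l\<in>L. b l \<le> s}. v l =
      (\<Sum>p\<in>{p\<in>P. c p \<le> s}. graded_coeff (b l) (c p) (B l p) * w p))"
      unfolding image_iff_graded[OF B fin(2)] f
    proof (safe, goal_cases)
      \<comment> \<open>In one direction the coordinates of degree \<open>s\<close> are taken; in
        the other a scalar solution is extended by zero in all other degrees.\<close>
      case (1 w)
      then show ?case
        by (intro exI[of _ "\<lambda>p. graded_coeff (c p) s (w p)"]) (auto dest!: spec[of _ s])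
    next
      case (2 w)
      have "\<forall>p. \<exists>f. \<forall>u. graded_coeff (c p) u f = (if u \<in> {s} \<and> c p \<le> u then w p else 0)"
        by (intro allI exists_graded_coeff) simp
      then obtain g where g: "\<And>p u. graded_coeff (c p) u (g p) = (if u = s \<and> c p \<le> u then w p else 0)"
        by (metis singleton_iff)
      show ?case
        by (rule exI[of _ g]) (use 2 in \<open>auto simp: g intro!: sum.cong\<close>)
    qed
    finally show "(\<forall>k\<in>{k\<in>K. a k \<le> s}.
            (\<Sum>l\<in>{l\<in>L. b l \<le> s}. graded_coeff (a k) (b l) (A k l) * v l) = 0 \<or> s - a k \<in> M)
      \<longleftrightarrow> (\<exists>w. \<forall>l\<in>{l\<in>L. b l \<le> s}. v l =
      (\<Sum>p\<in>{p\<in>P. c p \<le> s}. graded_coeff (b l) (c p) (B l p) * w p))" .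
  qed
next
  assume ex: "\<forall>s. exact_in_degree s M K L P a b c A B"
  show "exact_on M K L P A B"
    unfolding exact_on_def
  proof
    fix v :: "'j \<Rightarrow> ('x, 'k) mpoly"
    let ?im = "\<lambda>s w l. (\<Sum>p\<in>{p\<in>P. c p \<le> s}. graded_coeff (b l) (c p) (B l p) * w p)"
    have "(\<forall>k\<in>K. Poly_Mapping.keys (\<Sum>l\<in>L. A k l * v l) \<subseteq> M)
      \<longleftrightarrow> (\<forall>s. \<exists>w. \<forall>l\<in>{l\<in>L. b l \<le> s}. graded_coeff (b l) s (v l) = ?im s w l)"
      unfolding kernel_iff_graded[OF A fin(1)]
      using ex[unfolded exact_in_degree_def, rule_format] by (intro all_cong1)
    also have "\<dots> \<longleftrightarrow> (\<exists>w. \<forall>l\<in>L. v l = (\<Sum>p\<in>P. B l p * w p))"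
      unfolding image_iff_graded[OF B fin(2)]
    proof (intro iffI)
      assume "\<forall>s. \<exists>w. \<forall>l\<in>{l\<in>L. b l \<le> s}. graded_coeff (b l) s (v l) = ?im s w l"
      from choice[OF this] obtain W
        where W: "\<And>s l. l \<in> L \<Longrightarrow> b l \<le> s \<Longrightarrow> graded_coeff (b l) s (v l) = ?im s (W s) l"
        by blast
      \<comment> \<open>The degrees in which \<open>v\<close> has a nonzero coordinate. Outside
        \<open>S\<close> the glued \<open>w\<close> is zero, which is a preimage there.\<close>
      define S where "S = (\<Union>l\<in>L. {s. graded_coeff (b l) s (v l) \<noteq> 0})"
      have "finite S"
        using fin(1) by (simp add: S_def finite_degrees)
      then have "\<forall>p. \<exists>f. \<forall>s. graded_coeff (c p) s f = (if s \<in> S \<and> c p \<le> s then W s p else 0)"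
        by (intro allI exists_graded_coeff)
      then obtain w where w: "\<And>p s. graded_coeff (c p) s (w p) = (if s \<in> S \<and> c p \<le> s then W s p else 0)"
        by metis
      have "graded_coeff (b l) s (v l) = ?im s (\<lambda>p. graded_coeff (c p) s (w p)) l"
        if "l \<in> L" "b l \<le> s" for s l
      proof (cases "s \<in> S")
        case True
        then show ?thesis
          using W[OF that] by (auto simp: w intro!: sum.cong)
      next
        case False
        then show ?thesis
          using that by (auto simp: w S_def)
      qed
      then show "\<exists>w. \<forall>s. \<forall>l\<in>{l\<in>L. b l \<le> s}. graded_coeff (b l) s (v l) = ?im s (\<lambda>p. graded_coeff (c p) s (w p)) l"
        by blast
    next
      assume "\<exists>w. \<forall>s. \<forall>l\<in>{l\<in>L. b l \<le> s}. graded_coeff (b l) s (v l) = ?im s (\<lambda>p. graded_coeff (c p) s (w p)) l"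
      then obtain w where w: "\<forall>s. \<forall>l\<in>{l\<in>L. b l \<le> s}. graded_coeff (b l) s (v l)
          = ?im s (\<lambda>p. graded_coeff (c p) s (w p)) l"
        by blast
      show "\<forall>s. \<exists>w. \<forall>l\<in>{l\<in>L. b l \<le> s}. graded_coeff (b l) s (v l) = ?im s w l"
      proof
        show "\<exists>w. \<forall>l\<in>{l\<in>L. b l \<le> s}. graded_coeff (b l) s (v l) = ?im s w l" for s
          by (rule exI[of _ "\<lambda>p. graded_coeff (c p) s (w p)"]) (use w in blast)
      qed
    qed
    finally show "(\<forall>k\<in>K. Poly_Mapping.keys (\<Sum>l\<in>L. A k l * v l) \<subseteq> M)
      \<longleftrightarrow> (\<exists>w. \<forall>l\<in>L. v l = (\<Sum>p\<in>P. B l p * w p))" .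
  qed
qed

text \<open>The part of degree \<open>s\<close> of the restricted complex has the basis elements of degree at most
  \<open>s\<close> and at most \<open>m\<close>, so it coincides with the part of degree \<open>inf s m\<close> of the full complex.\<close>

lemma exact_on_restrict:
  assumes A: "homogeneous_matrix K L a b A" and B: "homogeneous_matrix L P b c B"
    and fin: "finite L" "finite P"
    and ex: "exact_on M K L P A B"
    and M': "\<And>k s. k \<in> K \<Longrightarrow> a k \<le> m \<Longrightarrow> a k \<le> s \<Longrightarrow> s - a k \<in> M' \<longleftrightarrow> inf s m - a k \<in> M"
  shows "exact_on M' {k\<in>K. a k \<le> m} {l\<in>L. b l \<le> m} {p\<in>P. c p \<le> m} A B"
proof -
  have hom: "homogeneous_matrix {k\<in>K. a k \<le> m} {l\<in>L. b l \<le> m} a b A"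
     "homogeneous_matrix {l\<in>L. b l \<le> m} {p\<in>P. c p \<le> m} b c B"
    using A B by (auto simp: homogeneous_matrix_def)
  have sets: "{k \<in> {k\<in>K. a k \<le> m}. a k \<le> s} = {k\<in>K. a k \<le> inf s m}"
    "{l \<in> {l\<in>L. b l \<le> m}. b l \<le> s} = {l\<in>L. b l \<le> inf s m}"
    "{p \<in> {p\<in>P. c p \<le> m}. c p \<le> s} = {p\<in>P. c p \<le> inf s m}" for s
    by auto
  have "exact_in_degree s M' {k\<in>K. a k \<le> m} {l\<in>L. b l \<le> m} {p\<in>P. c p \<le> m} a b c A B" for s
  proof -
    have "exact_in_degree (inf s m) M K L P a b c A B"
      using ex exact_on_iff_exact_in_degree[OF A B fin] by blast
    moreover have "s - a k \<in> M' \<longleftrightarrow> inf s m - a k \<in> M" if "k \<in> {k\<in>K. a k \<le> inf s m}" for k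
      using that M' by simp
    ultimately show ?thesis
      unfolding exact_in_degree_def sets by (simp del: le_inf_iff)
  qed
  then show ?thesis
    using exact_on_iff_exact_in_degree[OF hom] fin by simp
qed

text \<open>Renumbering bases transports vectors along the bijections. It is needed because a
  resolution has bases indexed by initial segments, whereas restriction leaves arbitrary subsets of
  them.\<close>

lemma exact_on_reindex:
  fixes A :: "'i \<Rightarrow> 'j \<Rightarrow> ('x, 'k::field) mpoly" and B :: "'j \<Rightarrow> 'l \<Rightarrow> ('x, 'k) mpoly" and g :: "'n \<Rightarrow> 'j"
  assumes f: "bij_betw f K' K" and g: "bij_betw g L' L" and h: "bij_betw h P' P"
    and ex: "exact_on M K L P A B"
  shows "exact_on M K' L' P' (\<lambda>k l. A (f k) (g l)) (\<lambda>l p. B (g l) (h p))"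
  unfolding exact_on_def
proof
  fix v :: "'n \<Rightarrow> ('x, 'k) mpoly"
  define u where "u l = v (inv_into L' g l)" for l
  have u: "u (g l) = v l" if "l \<in> L'" for l
    using that g by (simp add: u_def bij_betw_def)
  have "(\<forall>k\<in>K'. Poly_Mapping.keys (\<Sum>l\<in>L'. A (f k) (g l) * v l) \<subseteq> M)
    \<longleftrightarrow> (\<forall>k\<in>K'. Poly_Mapping.keys (\<Sum>l\<in>L'. A (f k) (g l) * u (g l)) \<subseteq> M)"
    by (simp add: u)
  also have "\<dots> \<longleftrightarrow> (\<forall>k\<in>K. Poly_Mapping.keys (\<Sum>l\<in>L. A k l * u l) \<subseteq> M)"
    unfolding bij_betw_imp_surj_on[OF f, symmetric]
    by (simp add: sum.reindex_bij_betw[OF g, of "\<lambda>l. A i l * u l" for i])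
  also have "\<dots> \<longleftrightarrow> (\<exists>w. \<forall>l\<in>L. u l = (\<Sum>p\<in>P. B l p * w p))"
    using ex by (simp add: exact_on_def)
  also have "\<dots> \<longleftrightarrow> (\<exists>w. \<forall>l\<in>L'. v l = (\<Sum>p\<in>P. B (g l) p * w p))"
    unfolding bij_betw_imp_surj_on[OF g, symmetric] by (simp add: u)
  also have "\<dots> \<longleftrightarrow> (\<exists>w. \<forall>l\<in>L'. v l = (\<Sum>p\<in>P'. B (g l) (h p) * w p))"
  proof safe
    fix w assume "\<forall>l\<in>L'. v l = (\<Sum>p\<in>P. B (g l) p * w p)"
    then show "\<exists>w. \<forall>l\<in>L'. v l = (\<Sum>p\<in>P'. B (g l) (h p) * w p)"
      unfolding sum.reindex_bij_betw[OF h, symmetric] by (intro exI[of _ "\<lambda>p. w (h p)"])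
  next
    fix w assume *: "\<forall>l\<in>L'. v l = (\<Sum>p\<in>P'. B (g l) (h p) * w p)"
    show "\<exists>w. \<forall>l\<in>L'. v l = (\<Sum>p\<in>P. B (g l) p * w p)"
      unfolding sum.reindex_bij_betw[OF h, symmetric]
      by (rule exI[of _ "\<lambda>p. w (inv_into P' h p)"]) (use * h in \<open>simp add: bij_betw_def\<close>)
  qed
  finally show "(\<forall>k\<in>K'. Poly_Mapping.keys (\<Sum>l\<in>L'. A (f k) (g l) * v l) \<subseteq> M)
    \<longleftrightarrow> (\<exists>w. \<forall>l\<in>L'. v l = (\<Sum>p\<in>P'. B (g l) (h p) * w p))" .
qed


section \<open>Restriction of minimal free resolutions\<close>

lemma mem_ideal_of_monom:
  fixes f :: "('x, 'k::field) mpoly"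
  shows "f \<in> ideal_of (monom ` T) \<longleftrightarrow> Poly_Mapping.keys f \<subseteq> {t. \<exists>s\<in>T. s \<le> t}"
proof -
  interpret module "(*) :: ('x, 'k) mpoly \<Rightarrow> _"
    by unfold_locales (simp_all add: algebra_simps)
  show ?thesis
    unfolding ideal_of_def
  proof
    assume "f \<in> span (monom ` T)"
    then show "Poly_Mapping.keys f \<subseteq> {t. \<exists>s\<in>T. s \<le> t}"
    proof (induction rule: span_induct_alt)
      case base
      then show ?case
        by simp
    next
      case (step c x y)
      then obtain s where s: "s \<in> T" "x = monom s"
        by blast
      have "Poly_Mapping.keys (c * x) \<subseteq> {t. s \<le> t}"
        using keys_mult[of c x] s by (auto simp: le_fun_def)
      then show ?case
        using keys_add[of "c * x" y] step.IH s(1) by blast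
    qed
  next
    assume keys: "Poly_Mapping.keys f \<subseteq> {t. \<exists>s\<in>T. s \<le> t}"
    \<comment> \<open>Each term of \<open>f\<close> is a multiple of a generator, and
      \<open>f\<close> is the sum of its terms.\<close>
    have "Poly_Mapping.single u c \<in> span (monom ` T)" if u: "u \<in> Poly_Mapping.keys f" for u c
    proof -
      obtain s where s: "s \<in> T" "s \<le> u"
        using u keys by blast
      then have "Poly_Mapping.single u c = Poly_Mapping.single (u - s) c * monom s"
        by (simp add: mult_single expo_diff_add)
      then show ?thesis
        using s by (auto intro: span_scale span_base)
    qed
    then show "f \<in> span (monom ` T)"
      by (subst poly_mapping_sum_single) (rule span_sum)
  qed
qed

lemma monom_mem_ideal_of: "(monom u :: ('x, 'k::field) mpoly) \<in> ideal_of (monom ` T) \<longleftrightarrow> (\<exists>s\<in>T. s \<le> u)"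
  by (simp add: mem_ideal_of_monom)

lemma mem_monomial_ideal:
  "monomial_ideal I \<Longrightarrow> f \<in> I \<longleftrightarrow> Poly_Mapping.keys f \<subseteq> {t. monom t \<in> I}"
  by (auto simp: monomial_ideal_def mem_ideal_of_monom)

lemma monomial_ideal_upward:
  "monomial_ideal I \<Longrightarrow> monom s \<in> I \<Longrightarrow> s \<le> t \<Longrightarrow> monom t \<in> I"
  by (clarsimp simp: monomial_ideal_def monom_mem_ideal_of) (meson order_trans)

text \<open>Among the monomials of \<open>I\<close> dividing that of exponent \<open>u\<close>, one
  of least total degree is minimal, since a proper divisor has smaller total degree.\<close>

lemma exists_min_gens_le:
  fixes I :: "('x::finite, 'k::field) mpoly set"
  assumes "monom u \<in> I"
  shows "\<exists>s\<in>min_gens I. s \<le> u"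
proof -
  obtain s where s: "monom s \<in> I" "s \<le> u"
    and least: "\<And>t. monom t \<in> I \<Longrightarrow> t \<le> u \<Longrightarrow> sum s UNIV \<le> sum t UNIV"
    using assms ex_has_least_nat[of "\<lambda>t. monom t \<in> I \<and> t \<le> u" u "\<lambda>t. sum t UNIV"] by blast
  have "t = s" if t: "monom t \<in> I" "t \<le> s" for t
  proof
    fix x
    have "sum t UNIV = sum s UNIV"
      using t(2) by (intro antisym[OF sum_mono least[OF t(1) order_trans[OF t(2) s(2)]]]) (simp add: le_fun_def)
    then show "t x = s x"
      by (rule sum_mono_inv) (use t(2) in \<open>auto simp: le_fun_def\<close>)
  qed
  then show ?thesis
    using s by (auto simp: min_gens_def)
qed

lemma monomial_ideal_ideal_le: "monomial_ideal (ideal_le I m)"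
  by (auto simp: monomial_ideal_def ideal_le_def)

text \<open>A generator divides both \<open>u\<close> and \<open>m\<close> iff it divides their gcd
  \<open>inf u m\<close>. This links degree \<open>u\<close> of the restricted ideal with degree
  \<open>inf u m\<close> of \<open>I\<close>.\<close>

lemma monom_mem_ideal_le:
  fixes I :: "('x::finite, 'k::field) mpoly set"
  assumes "monomial_ideal I"
  shows "monom u \<in> ideal_le I m \<longleftrightarrow> monom (inf u m) \<in> I"
proof
  assume "monom u \<in> ideal_le I m"
  then obtain s where "s \<in> min_gens I" "s \<le> inf u m"
    by (auto simp: ideal_le_def monom_mem_ideal_of)
  then show "monom (inf u m) \<in> I"
    using monomial_ideal_upward[OF assms] by (auto simp: min_gens_def)
next
  assume "monom (inf u m) \<in> I"
  from exists_min_gens_le[OF this] show "monom u \<in> ideal_le I m"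
    by (auto simp: ideal_le_def monom_mem_ideal_of)
qed

lemma min_gens_ideal_le:
  fixes I :: "('x::finite, 'k::field) mpoly set"
  assumes "monomial_ideal I"
  shows "min_gens (ideal_le I m) = {t \<in> min_gens I. t \<le> m}"
proof (intro set_eqI iffI)
  fix t assume t: "t \<in> min_gens (ideal_le I m)"
  \<comment> \<open>The gcd of \<open>t\<close> and \<open>m\<close> lies in the restricted ideal as
    well, so minimality of \<open>t\<close> forces \<open>t\<close> to divide
    \<open>m\<close>.\<close>
  then have "monom (inf t m) \<in> ideal_le I m"
    by (simp add: min_gens_def monom_mem_ideal_le[OF assms])
  then have "inf t m = t"
    using t by (simp add: min_gens_def)
  moreover have "s = t" if "monom s \<in> I" "s \<le> t" for s
  proof -
    have "inf s m = s"
      using that \<open>inf t m = t\<close> by (metis inf.absorb_iff1 inf.orderE inf_assoc)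
    then show ?thesis
      using that t by (simp add: min_gens_def monom_mem_ideal_le[OF assms])
  qed
  ultimately show "t \<in> {t \<in> min_gens I. t \<le> m}"
    using t by (auto simp: min_gens_def monom_mem_ideal_le[OF assms] inf.absorb_iff1)
next
  fix t assume t: "t \<in> {t \<in> min_gens I. t \<le> m}"
  then have inf: "inf s m = s" if "s \<le> t" for s
    using that by (simp add: inf.absorb1 order_trans[of s t m])
  then show "t \<in> min_gens (ideal_le I m)"
    using t by (auto simp: min_gens_def monom_mem_ideal_le[OF assms] inf)
qed

section \<open>The restricted resolution and its Betti numbers\<close>

lemma restrict_surjective_augmentation:
  fixes I :: "('x::finite, 'k::field) mpoly set" and n :: nat
  assumes I: "monomial_ideal I"
    and hom: "\<And>k. k < n \<Longrightarrow> Poly_Mapping.keys (e k) \<subseteq> {d k}"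
    and surj: "(\<Sum>k<n. v k * e k) - 1 \<in> I"
  shows "\<exists>w. (\<Sum>k\<in>{k\<in>{..<n}. d k \<le> m}. w k * e k) - 1 \<in> ideal_le I m"
proof (cases "monom 0 \<in> I")
  case True
  have "monom 0 \<in> ideal_le I m"
    unfolding monom_mem_ideal_le[OF I] by (rule monomial_ideal_upward[OF I True]) (simp add: le_fun_def)
  then have "monom t \<in> ideal_le I m" for t
    by (rule monomial_ideal_upward[OF monomial_ideal_ideal_le]) (simp add: le_fun_def)
  then have "(\<Sum>k\<in>{k\<in>{..<n}. d k \<le> m}. 0 * e k) - 1 \<in> ideal_le I m"
    by (intro mem_monomial_ideal[OF monomial_ideal_ideal_le, THEN iffD2]) blast
  then show ?thesis
    by (rule exI[of _ "\<lambda>_. 0"])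
next
  case False
  \<comment> \<open>As 1 has degree 0, only basis elements of degree 0 matter, and these survive
    since \<open>0 \<le> m\<close>. The augmentation is read as a matrix with a single row of degree
    0.\<close>
  have homm: "homogeneous_matrix (UNIV :: unit set) {..<n} (\<lambda>_. 0) d (\<lambda>_. e)"
    using hom by (auto simp: homogeneous_matrix_def)
  define D where "D = {k\<in>{..<n}. d k \<le> 0}"
  have d: "d k = 0" if "k \<in> D" for k
    using that by (auto simp: D_def le_fun_def)
  define w :: "nat \<Rightarrow> ('x, 'k) mpoly" where "w k = (if k \<in> D then Poly_Mapping.single 0 (graded_coeff 0 0 (v k)) else 0)" for k
  have e: "e k = Poly_Mapping.single 0 (graded_coeff 0 0 (e k))" if "k \<in> D" for k
    using homogeneous_matrixD[OF homm, of "()" k] d[OF that] that by (simp add: D_def)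
  \<comment> \<open>Since 1 is not in \<open>I\<close>, no element of \<open>I\<close> has a
    constant term.\<close>
  have "Poly_Mapping.lookup ((\<Sum>k<n. v k * e k) - 1) 0 = 0"
    using mem_monomial_ideal[OF I, THEN iffD1, OF surj] False by (auto simp: in_keys_iff)
  then have "1 = graded_coeff 0 0 (\<Sum>k<n. e k * v k)"
    by (simp add: graded_coeff_def lookup_minus lookup_one mult.commute)
  also have "\<dots> = (\<Sum>k\<in>D. graded_coeff 0 0 (e k) * graded_coeff 0 0 (v k))"
    using graded_coeff_mult_vector[OF homm, of "()" 0 v, OF UNIV_I finite_lessThan, folded D_def] by (simp add: d)
  finally have one: "(\<Sum>k\<in>D. graded_coeff 0 0 (e k) * graded_coeff 0 0 (v k)) = 1" ..
  have "(\<Sum>k\<in>{k\<in>{..<n}. d k \<le> m}. w k * e k) = (\<Sum>k\<in>D. w k * e k)"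
  proof (rule sum.mono_neutral_right)
    have "(0 :: 'x expo) \<le> m"
      by (simp add: le_fun_def)
    then show "D \<subseteq> {k\<in>{..<n}. d k \<le> m}"
      by (auto simp: D_def intro: order_trans)
  qed (auto simp: w_def)
  also have "\<dots> = (\<Sum>k\<in>D. Poly_Mapping.single 0 (graded_coeff 0 0 (e k) * graded_coeff 0 0 (v k)))"
  proof (rule sum.cong)
    fix k assume "k \<in> D"
    then show "w k * e k = Poly_Mapping.single 0 (graded_coeff 0 0 (e k) * graded_coeff 0 0 (v k))"
      by (subst e) (simp_all add: w_def mult_single mult.commute)
  qed simp
  also have "\<dots> = Poly_Mapping.single 0 (\<Sum>k\<in>D. graded_coeff 0 0 (e k) * graded_coeff 0 0 (v k))"
    by (rule poly_mapping_eqI) (auto simp: lookup_sum lookup_single when_def)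
  also have "\<dots> = 1"
    by (simp add: one)
  finally have "Poly_Mapping.keys ((\<Sum>k\<in>{k\<in>{..<n}. d k \<le> m}. w k * e k) - 1) = {}"
    by simp
  then show ?thesis
    by (intro exI[of _ w] mem_monomial_ideal[OF monomial_ideal_ideal_le, THEN iffD2]) blast
qed

text \<open>Homogeneity and minimality are inherited, as all matrix entries are old ones. Exactness
  comes from \<open>exact_on_restrict\<close>, with the empty set of exponents at the differentials
  and the exponents of the ideals at the augmentation.\<close>

lemma minimal_free_resolution_ideal_le:
  fixes I :: "('x::finite, 'k::field) mpoly set"
  assumes I: "monomial_ideal I" and res: "minimal_free_resolution I r d e A"
    and h: "\<And>i. bij_betw (h i) {..<r' i} {k\<in>{..<r i}. d i k \<le> m}"
  shows "minimal_free_resolution (ideal_le I m) r' (\<lambda>i k. d i (h i k)) (\<lambda>k. e (h 0 k))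
    (\<lambda>i k l. A i (h i k) (h (Suc i) l))"
proof -
  interpret minimal_free_resolution I r d e A
    by (rule res)
  let ?S = "\<lambda>i. {k\<in>{..<r i}. d i k \<le> m}"
  have hr: "h i k < r i" if "k < r' i" for i k
    using bij_betwE[OF h] that by blast
  have hom: "homogeneous_matrix {..<r i} {..<r (Suc i)} (d i) (d (Suc i)) (A i)" for i
    using homogeneous_differential by (auto simp: homogeneous_matrix_def)
  have hom_aug: "homogeneous_matrix (UNIV :: unit set) {..<r 0} (\<lambda>_. 0) (d 0) (\<lambda>_. e)"
    using homogeneous_augmentation by (auto simp: homogeneous_matrix_def)
  have "exact_on {} {..<r i} {..<r (Suc i)} {..<r (Suc (Suc i))} (A i) (A (Suc i))" for i
    using exact_differential by (simp add: exact_on_def Ball_def)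
  then have "exact_on {} (?S i) (?S (Suc i)) (?S (Suc (Suc i))) (A i) (A (Suc i))" for i
    by (intro exact_on_restrict[OF hom hom]) auto
  from exact_on_reindex[OF h h h this]
  have exact: "exact_on {} {..<r' i} {..<r' (Suc i)} {..<r' (Suc (Suc i))}
      (\<lambda>k l. A i (h i k) (h (Suc i) l)) (\<lambda>l p. A (Suc i) (h (Suc i) l) (h (Suc (Suc i)) p))" for i .
  have "exact_on {t. monom t \<in> I} (UNIV :: unit set) {..<r 0} {..<r (Suc 0)} (\<lambda>_. e) (A 0)"
    using exact_augmentation
    by (simp add: exact_on_def Ball_def mult.commute mem_monomial_ideal[OF I, of "sum _ _", symmetric])
  \<comment> \<open>The only row has degree 0 and is kept. The required relation between the two
    exponent sets is \<open>monom_mem_ideal_le\<close>.\<close>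
  then have "exact_on {t. monom t \<in> ideal_le I m} {k\<in>UNIV :: unit set. 0 \<le> m} (?S 0) (?S (Suc 0)) (\<lambda>_. e) (A 0)"
    by (intro exact_on_restrict[OF hom_aug hom]) (auto simp: monom_mem_ideal_le[OF I])
  moreover have "bij_betw id (UNIV :: unit set) {k\<in>UNIV :: unit set. 0 \<le> m}"
    by (simp add: le_fun_def)
  ultimately have exact_aug: "exact_on {t. monom t \<in> ideal_le I m} (UNIV :: unit set) {..<r' 0} {..<r' (Suc 0)}
      (\<lambda>_ l. e (h 0 l)) (\<lambda>l p. A 0 (h 0 l) (h (Suc 0) p))"
    using exact_on_reindex[OF _ h h] by blast
  obtain v where "(\<Sum>k<r 0. v k * e k) - 1 \<in> I"
    using surjective_augmentation by blast
  from restrict_surjective_augmentation[OF I homogeneous_augmentation this, of m]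
  obtain w where w: "(\<Sum>k\<in>?S 0. w k * e k) - 1 \<in> ideal_le I m"
    by blast
  show ?thesis
  proof
    show "Poly_Mapping.keys (e (h 0 k)) \<subseteq> {d 0 (h 0 k)}" if "k < r' 0" for k
      using homogeneous_augmentation hr that by blast
    show "d i (h i k) + t = d (Suc i) (h (Suc i) l)"
      if "k < r' i" "l < r' (Suc i)" "t \<in> Poly_Mapping.keys (A i (h i k) (h (Suc i) l))" for i k l t
      using homogeneous_differential hr that by blast
    show "\<exists>v. (\<Sum>k<r' 0. v k * e (h 0 k)) - 1 \<in> ideal_le I m"
      using w unfolding sum.reindex_bij_betw[OF h, symmetric] by (rule exI[of _ "\<lambda>k. w (h 0 k)"])
    show "(\<Sum>k<r' 0. v k * e (h 0 k)) \<in> ideal_le I m \<longleftrightarrow>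
        (\<exists>w. \<forall>k<r' 0. v k = (\<Sum>l<r' 1. A 0 (h 0 k) (h (Suc 0) l) * w l))" for v
      using exact_aug
      by (simp add: exact_on_def Ball_def mult.commute mem_monomial_ideal[OF monomial_ideal_ideal_le, of "sum _ _", symmetric])
    show "(\<forall>k<r' i. (\<Sum>l<r' (Suc i). A i (h i k) (h (Suc i) l) * v l) = 0) \<longleftrightarrow>
         (\<exists>w. \<forall>l<r' (Suc i). v l = (\<Sum>p<r' (Suc (Suc i)). A (Suc i) (h (Suc i) l) (h (Suc (Suc i)) p) * w p))"
      for i v
      using exact by (simp add: exact_on_def Ball_def)
    show "Poly_Mapping.lookup (A i (h i k) (h (Suc i) l)) 0 = 0" if "k < r' i" "l < r' (Suc i)" for i k l
      using minimal hr that by blast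
  qed
qed

text \<open>The basis of the restricted resolution consists of the old basis elements of degree
  dividing \<open>m\<close>, renumbered by \<open>h\<close>.\<close>

lemma multigraded_betti_numbers_ideal_le:
  fixes I :: "('x::finite, 'k::field) mpoly set"
  assumes I: "monomial_ideal I" and betti: "multigraded_betti_numbers I \<beta>"
  shows "multigraded_betti_numbers (ideal_le I m) (\<lambda>i \<alpha>. if \<alpha> \<le> m then \<beta> i \<alpha> else 0)"
proof -
  obtain r d e A where res: "minimal_free_resolution I r d e A"
    and \<beta>: "\<And>i \<alpha>. \<beta> i \<alpha> = card {k. k < r i \<and> d i k = \<alpha>}"
    using betti by (auto simp: multigraded_betti_numbers_def)
  have "\<exists>h. bij_betw h {..<card {k\<in>{..<r i}. d i k \<le> m}} {k\<in>{..<r i}. d i k \<le> m}" for i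
    unfolding lessThan_atLeast0 by (intro ex_bij_betw_nat_finite) simp
  then have "\<forall>i. \<exists>h. bij_betw h {..<card {k\<in>{..<r i}. d i k \<le> m}} {k\<in>{..<r i}. d i k \<le> m}"
    by blast
  from choice[OF this] obtain h
    where h: "\<And>i. bij_betw (h i) {..<card {k\<in>{..<r i}. d i k \<le> m}} {k\<in>{..<r i}. d i k \<le> m}"
    by blast
  have "(if \<alpha> \<le> m then \<beta> i \<alpha> else 0)
      = card {k. k < card {k\<in>{..<r i}. d i k \<le> m} \<and> d i (h i k) = \<alpha>}" for i \<alpha>
  proof -
    let ?K = "{..<card {k\<in>{..<r i}. d i k \<le> m}}"
    have "inj_on (h i) {k\<in>?K. d i (h i k) = \<alpha>}"
      using h[of i] by (auto simp: bij_betw_def intro: inj_on_subset)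
    moreover have "h i ` {k\<in>?K. d i (h i k) = \<alpha>} = {k \<in> h i ` ?K. d i k = \<alpha>}"
      by blast
    moreover have "\<dots> = (if \<alpha> \<le> m then {k. k < r i \<and> d i k = \<alpha>} else {})"
      unfolding bij_betw_imp_surj_on[OF h] by auto
    ultimately have "card {k\<in>?K. d i (h i k) = \<alpha>} = (if \<alpha> \<le> m then \<beta> i \<alpha> else 0)"
      by (metis (no_types, lifting) \<beta> card.empty card_image)
    then show ?thesis
      by simp
  qed
  then show ?thesis
    using minimal_free_resolution_ideal_le[OF I res h] by (auto simp: multigraded_betti_numbers_def)
qed


section \<open>Restriction of the pruning algorithm\<close>

lemma lcm_face_le_iff:
  "finite \<sigma> \<Longrightarrow> lcm_face ms \<sigma> \<le> m \<longleftrightarrow> (\<forall>i\<in>\<sigma>. ms ! i \<le> m)"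
  by (auto simp: lcm_face_def le_fun_def)

lemma lcm_face_reindex:
  assumes "\<sigma> \<subseteq> {..<length idx}"
  shows "lcm_face (map ((!) ms) idx) \<sigma> = lcm_face ms ((!) idx ` \<sigma>)"
proof -
  have "(\<lambda>i. (map ((!) ms) idx ! i) x) ` \<sigma> = (\<lambda>i. (ms ! (idx ! i)) x) ` \<sigma>" for x
    using assms by (intro image_cong) auto
  then show ?thesis
    by (simp add: lcm_face_def image_image)
qed

text \<open>The faces used up before step \<open>j\<close>. The edges themselves can be forgotten,
  since later steps and criticality depend only on their union.\<close>

definition matched_below :: "'x expo list \<Rightarrow> nat \<Rightarrow> nat set set" where
  "matched_below ms j = \<Union>(fold (prune_step ms) [0..<j] {})"

lemma critical_faces_eq: "critical_faces ms = Pow {..<length ms} - matched_below ms (length ms)"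
  unfolding critical_faces_def pruned_edges_def matched_below_def by (rule refl)

lemma matched_below_0: "matched_below ms 0 = {}"
  by (simp add: matched_below_def)

text \<open>At step \<open>j\<close> the only candidate edge through \<open>\<tau>\<close> joins
  \<open>\<tau> - {j}\<close> and \<open>insert j \<tau>\<close>, whichever of the two
  \<open>\<tau>\<close> is.\<close>

lemma mem_matched_below_Suc:
  assumes "j < length ms"
  shows "\<tau> \<in> matched_below ms (Suc j) \<longleftrightarrow> \<tau> \<in> matched_below ms j \<or>
    \<tau> \<subseteq> {..<length ms} \<and> lcm_face ms (\<tau> - {j}) = lcm_face ms (insert j \<tau>) \<and>
    \<tau> - {j} \<notin> matched_below ms j \<and> insert j \<tau> \<notin> matched_below ms j"
    (is "_ \<longleftrightarrow> _ \<or> ?R")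
proof -
  define E where "E = fold (prune_step ms) [0..<j] {}"
  define C where "C = {{\<sigma>, insert j \<sigma>} | \<sigma>. \<sigma> \<subseteq> {..<length ms} \<and> j \<notin> \<sigma> \<and>
        lcm_face ms \<sigma> = lcm_face ms (insert j \<sigma>) \<and> \<sigma> \<notin> \<Union>E \<and> insert j \<sigma> \<notin> \<Union>E}"
  have mE: "matched_below ms j = \<Union>E" and mS: "matched_below ms (Suc j) = \<Union>E \<union> \<Union>C"
    by (simp_all add: matched_below_def E_def C_def prune_step_def)
  have "\<tau> \<in> \<Union>C \<longleftrightarrow> ?R"
  proof
    assume "\<tau> \<in> \<Union>C"
    then obtain \<sigma> where "\<sigma> \<subseteq> {..<length ms}" "j \<notin> \<sigma>" "lcm_face ms \<sigma> = lcm_face ms (insert j \<sigma>)"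
      "\<sigma> \<notin> \<Union>E" "insert j \<sigma> \<notin> \<Union>E" "\<tau> = \<sigma> \<or> \<tau> = insert j \<sigma>"
      by (auto simp: C_def)
    moreover from this have "\<tau> - {j} = \<sigma>" "insert j \<tau> = insert j \<sigma>"
      by auto
    ultimately show ?R
      using assms by (auto simp: mE)
  next
    assume R: ?R
    then have "{\<tau> - {j}, insert j (\<tau> - {j})} \<in> C"
      unfolding C_def mE mem_Collect_eq
      by (intro exI[of _ "\<tau> - {j}"]) (simp add: subset_iff)
    moreover have "\<tau> \<in> {\<tau> - {j}, insert j (\<tau> - {j})}"
      by auto
    ultimately show "\<tau> \<in> \<Union>C"
      by blast
  qed
  then show ?thesis
    by (simp add: mE mS)
qed

text \<open>The list \<open>idx\<close> holds the positions of the generators dividing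
  \<open>m\<close> in increasing order, so the sublist keeps the given order and
  \<open>(!) idx\<close> embeds the smaller simplex into the larger one.\<close>

context
  fixes ms :: "'x expo list" and m :: "'x expo" and idx :: "nat list"
  defines "idx \<equiv> filter (\<lambda>i. ms ! i \<le> m) [0..<length ms]"
begin

lemma inj_on_idx: "inj_on ((!) idx) {..<length idx}"
  by (auto intro!: inj_on_nth simp: idx_def)

lemma nth_idx: "i < length idx \<Longrightarrow> idx ! i < length ms \<and> ms ! (idx ! i) \<le> m"
  using nth_mem[of i idx] by (auto simp: idx_def)

lemma image_idx: "(!) idx ` {..<length idx} = {i. i < length ms \<and> ms ! i \<le> m}"
proof -
  have "(!) idx ` {..<length idx} = set idx"
    by (auto simp: in_set_conv_nth)
  then show ?thesis
    by (auto simp: idx_def)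
qed

text \<open>An edge at step \<open>j\<close> has multidegree divisible by \<open>ms ! j\<close>; as pruning only ever compares
  faces of equal multidegree, the steps with \<open>ms ! j\<close> not dividing \<open>m\<close> leave the faces of
  multidegree dividing \<open>m\<close> alone.\<close>

lemma matched_below_restrict:
  assumes "j \<le> length ms" "\<sigma> \<subseteq> {..<length idx}"
  shows "(!) idx ` \<sigma> \<in> matched_below ms j \<longleftrightarrow>
    \<sigma> \<in> matched_below (map ((!) ms) idx) (length (filter (\<lambda>i. ms ! i \<le> m) [0..<j]))"
  using assms
proof (induction j arbitrary: \<sigma>)
  case 0
  then show ?case
    by (simp add: matched_below_0)
next
  case (Suc j)
  let ?g = "(!) idx" and ?ms = "map ((!) ms) idx"
  \<comment> \<open>The number of steps made on the sublist when \<open>j\<close> steps have been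
    made on \<open>ms\<close>.\<close>
  let ?J = "length (filter (\<lambda>i. ms ! i \<le> m) [0..<j])"
  have IH: "?g ` \<tau> \<in> matched_below ms j \<longleftrightarrow> \<tau> \<in> matched_below ?ms ?J" if "\<tau> \<subseteq> {..<length idx}" for \<tau>
    using Suc that by simp
  have fin: "finite \<sigma>"
    using Suc.prems finite_subset by blast
  have sub: "?g ` \<sigma> \<subseteq> {..<length ms}" and le: "\<forall>i\<in>?g ` \<sigma>. ms ! i \<le> m"
    using Suc.prems nth_idx by auto
  have j: "j < length ms"
    using Suc.prems by simp
  show ?case
  proof (cases "ms ! j \<le> m")
    case True
    \<comment> \<open>The split shows that \<open>j\<close> stands at position \<open>?J\<close> of
      \<open>idx\<close>, so step \<open>j\<close> on \<open>ms\<close> corresponds to step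
      \<open>?J\<close> on the sublist.\<close>
    have idx_split: "idx = filter (\<lambda>i. ms ! i \<le> m) [0..<j] @ j # filter (\<lambda>i. ms ! i \<le> m) [Suc j..<length ms]"
    proof -
      have "[0..<length ms] = [0..<j] @ [j..<length ms]"
        using upt_add_eq_append[of 0 j "length ms - j"] j by simp
      also have "[j..<length ms] = j # [Suc j..<length ms]"
        using j by (rule upt_conv_Cons)
      finally show ?thesis
        using True by (simp add: idx_def)
    qed
    have J: "?J < length idx" "idx ! ?J = j"
      by (subst idx_split, simp)+
    have J': "?J < length ?ms"
      using J by simp
    have del: "?g ` (\<sigma> - {?J}) = ?g ` \<sigma> - {j}"
      using J Suc.prems inj_on_idx by (auto simp: inj_on_def)
    have ins: "?g ` insert ?J \<sigma> = insert j (?g ` \<sigma>)"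
      using J by simp
    have subs: "\<sigma> - {?J} \<subseteq> {..<length idx}" "insert ?J \<sigma> \<subseteq> {..<length idx}"
      using J Suc.prems by auto
    have len: "length (filter (\<lambda>i. ms ! i \<le> m) [0..<Suc j]) = Suc ?J"
      using True by simp
    show ?thesis
      unfolding len mem_matched_below_Suc[OF j] mem_matched_below_Suc[OF J']
        IH[OF Suc.prems(2), symmetric] IH[OF subs(1), symmetric] IH[OF subs(2), symmetric]
        lcm_face_reindex[OF subs(1)] lcm_face_reindex[OF subs(2)] del ins
      using sub Suc.prems by simp
  next
    case False
    \<comment> \<open>The two ends of the candidate edge have different multidegrees, as only one of
      these divides \<open>m\<close>. Hence step \<open>j\<close> does not match this face.\<close>
    have "\<not> lcm_face ms (insert j (?g ` \<sigma>)) \<le> m" "lcm_face ms (?g ` \<sigma> - {j}) \<le> m"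
      using False le fin by (auto simp: lcm_face_le_iff)
    then show ?thesis
      unfolding mem_matched_below_Suc[OF j] using False IH[OF Suc.prems(2)] by auto
  qed
qed

text \<open>After the last step both algorithms have finished, so matched faces correspond. A face
  of multidegree dividing \<open>m\<close> has only vertices listed in \<open>idx\<close> and
  therefore is an image.\<close>

lemma critical_faces_restrict:
  "bij_betw ((`) ((!) idx)) (critical_faces (map ((!) ms) idx))
     {\<sigma> \<in> critical_faces ms. lcm_face ms \<sigma> \<le> m}"
proof -
  let ?g = "(!) idx" and ?ms = "map ((!) ms) idx"
  have iff: "?g ` \<sigma> \<in> matched_below ms (length ms) \<longleftrightarrow> \<sigma> \<in> matched_below ?ms (length ?ms)"
    if "\<sigma> \<subseteq> {..<length idx}" for \<sigma>
    using matched_below_restrict[OF order_refl that] by (simp add: idx_def)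
  have "(`) ?g ` critical_faces ?ms = {\<sigma> \<in> critical_faces ms. lcm_face ms \<sigma> \<le> m}" (is "?A = ?B")
  proof
    show "?A \<subseteq> ?B"
    proof clarify
      fix \<sigma> assume \<sigma>: "\<sigma> \<in> critical_faces ?ms"
      then have sub: "\<sigma> \<subseteq> {..<length idx}"
        by (simp add: critical_faces_eq)
      moreover have "finite \<sigma>"
        using sub finite_subset by blast
      ultimately show "?g ` \<sigma> \<in> critical_faces ms \<and> lcm_face ms (?g ` \<sigma>) \<le> m"
        using \<sigma> iff[OF sub] nth_idx by (auto simp: critical_faces_eq lcm_face_le_iff)
    qed
    show "?B \<subseteq> ?A"
    proof
      fix \<tau> assume \<tau>: "\<tau> \<in> ?B"
      then have "\<tau> \<subseteq> {..<length ms}"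
        by (simp add: critical_faces_eq)
      moreover from this have "finite \<tau>"
        using finite_subset by blast
      ultimately have "\<tau> \<subseteq> ?g ` {..<length idx}"
        using \<tau> by (auto simp: image_idx lcm_face_le_iff)
      then obtain \<sigma> where "\<sigma> \<subseteq> {..<length idx}" "\<tau> = ?g ` \<sigma>"
        by (metis subset_imageE)
      then show "\<tau> \<in> ?A"
        using \<tau> iff by (auto simp: critical_faces_eq)
    qed
  qed
  moreover have "inj_on ((`) ?g) (critical_faces ?ms)"
    using inj_on_image_Pow[OF inj_on_idx] by (rule inj_on_subset) (auto simp: critical_faces_eq)
  ultimately show ?thesis
    by (simp add: bij_betw_def)
qed

text \<open>The bijection preserves cardinality and multidegree, and multidegrees not dividing
  \<open>m\<close> do not occur for the sublist.\<close>

lemma card_critical_faces_restrict: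
  "card {\<sigma> \<in> critical_faces (map ((!) ms) idx). card \<sigma> = i \<and> lcm_face (map ((!) ms) idx) \<sigma> = \<alpha>}
   = (if \<alpha> \<le> m then card {\<sigma> \<in> critical_faces ms. card \<sigma> = i \<and> lcm_face ms \<sigma> = \<alpha>} else 0)"
proof -
  let ?g = "(!) idx" and ?ms = "map ((!) ms) idx"
  note bij = critical_faces_restrict
  have eq: "card (?g ` \<sigma>) = card \<sigma>" "lcm_face ms (?g ` \<sigma>) = lcm_face ?ms \<sigma>"
    if "\<sigma> \<in> critical_faces ?ms" for \<sigma>
  proof -
    have sub: "\<sigma> \<subseteq> {..<length idx}"
      using that by (simp add: critical_faces_def)
    then show "card (?g ` \<sigma>) = card \<sigma>"
      by (intro card_image inj_on_subset[OF inj_on_idx])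
    show "lcm_face ms (?g ` \<sigma>) = lcm_face ?ms \<sigma>"
      by (rule lcm_face_reindex[OF sub, symmetric])
  qed
  have "(`) ?g ` {\<sigma> \<in> critical_faces ?ms. card \<sigma> = i \<and> lcm_face ?ms \<sigma> = \<alpha>}
    = {\<tau> \<in> (`) ?g ` critical_faces ?ms. card \<tau> = i \<and> lcm_face ms \<tau> = \<alpha>}"
    by (auto simp: eq)
  also have "\<dots> = {\<tau> \<in> critical_faces ms. lcm_face ms \<tau> \<le> m \<and> card \<tau> = i \<and> lcm_face ms \<tau> = \<alpha>}"
    using bij by (auto simp: bij_betw_def)
  also have "\<dots> = (if \<alpha> \<le> m then {\<sigma> \<in> critical_faces ms. card \<sigma> = i \<and> lcm_face ms \<sigma> = \<alpha>} else {})"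
    by auto
  finally have "card ((`) ?g ` {\<sigma> \<in> critical_faces ?ms. card \<sigma> = i \<and> lcm_face ?ms \<sigma> = \<alpha>}) =
    (if \<alpha> \<le> m then card {\<sigma> \<in> critical_faces ms. card \<sigma> = i \<and> lcm_face ms \<sigma> = \<alpha>} else 0)"
    by simp
  moreover have "inj_on ((`) ?g) {\<sigma> \<in> critical_faces ?ms. card \<sigma> = i \<and> lcm_face ?ms \<sigma> = \<alpha>}"
    using bij by (auto simp: bij_betw_def intro: inj_on_subset)
  ultimately show ?thesis
    by (simp add: card_image)
qed

end


theorem corollary3p11:
  fixes I :: "('x::finite, 'k::field) mpoly set" and m :: "'x expo"
  assumes "monomial_ideal I"
    and "admits_minimal_pruned_resolution I"
  shows "admits_minimal_pruned_resolution (ideal_le I m)"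
proof -
  obtain ms where ms: "distinct ms" "set ms = min_gens I"
    and betti: "multigraded_betti_numbers I
      (\<lambda>i \<alpha>. card {\<sigma> \<in> critical_faces ms. card \<sigma> = i \<and> lcm_face ms \<sigma> = \<alpha>})"
    using assms(2) by (auto simp: admits_minimal_pruned_resolution_def)
  let ?idx = "filter (\<lambda>i. ms ! i \<le> m) [0..<length ms]"
  have "distinct (map ((!) ms) ?idx)"
    using ms(1) by (simp add: distinct_map inj_on_def nth_eq_iff_index_eq)
  moreover have "set (map ((!) ms) ?idx) = min_gens (ideal_le I m)"
    unfolding min_gens_ideal_le[OF assms(1)] ms(2)[symmetric] by (auto simp: in_set_conv_nth)
  \<comment> \<open>Face counts and Betti numbers are both truncated to the multidegrees dividing
    \<open>m\<close>, so their equality persists.\<close>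
  moreover have "multigraded_betti_numbers (ideal_le I m) (\<lambda>i \<alpha>. card {\<sigma> \<in> critical_faces (map ((!) ms) ?idx).
      card \<sigma> = i \<and> lcm_face (map ((!) ms) ?idx) \<sigma> = \<alpha>})"
    unfolding card_critical_faces_restrict by (rule multigraded_betti_numbers_ideal_le[OF assms(1) betti])
  ultimately show ?thesis
    unfolding admits_minimal_pruned_resolution_def by blast
qed

end
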